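(* For every integer $j\ge 1$, $$\zeta(2j+1)=(-1)^j\frac{2^{2j}\pi^{2j+1}}{(2j)!\,(2^{2j+1}-1)}\int_{0}^{1/2}E_{2j}(x)\csc(\pi x)\,dx .$$
   Context: $\zeta$ is the Riemann zeta function. The Euler polynomials $E_n(x)$ are defined by $\frac{2}{e^t+1}e^{xt}=\sum_{n\ge 0}E_n(x)\frac{t^n}{n!}$. *)

theory Defs
  imports "HOL-Analysis.Analysis"
begin

text \<open>
  The Riemann zeta function: the Dirichlet series on the half-plane \<open>Re s > 1\<close>, and elsewhere
  its analytic continuation to the plane punctured at \<open>1\<close>, which is unique because the punctured
  plane is connected. The value at the pole is \<open>0\<close> by convention.
\<close>

definition zeta :: "complex \<Rightarrow> complex" where
  "zeta s =
     (if Re s > 1 then (\<Sum>n. 1 / of_nat (Suc n) powr s)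
      else if s = 1 then 0
      else (THE z. \<exists>f. f holomorphic_on (- {1}) \<and>
              (\<forall>w. Re w > 1 \<longrightarrow> f w = (\<Sum>n. 1 / of_nat (Suc n) powr w)) \<and> f s = z))"

text \<open>
  The generating function is read as a formal power series in \<open>t\<close> for fixed \<open>x\<close>: \<open>fps_exp c\<close> is
  the series of \<open>exp (c * t)\<close>, and the denominator has constant term \<open>2\<close>, so it is invertible.
\<close>

definition euler_poly :: "nat \<Rightarrow> real \<Rightarrow> real" where
  "euler_poly n x = fact n * fps_nth (2 / (fps_exp 1 + 1) * fps_exp x) n"

lemma euler_poly_generating_function:
  "Abs_fps (\<lambda>n. euler_poly n x / fact n) = 2 / (fps_exp 1 + 1) * fps_exp x"
  by (rule fps_ext) (simp add: euler_poly_def)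

definition csc :: "real \<Rightarrow> real" where
  "csc x = 1 / sin x"

end

theory Submission
  imports Defs
begin

text \<open>
  Since \<open>2 sin y (sin y + sin 3y + \<dots> + sin (2n - 1)y) = 1 - cos 2ny\<close>, the Riemann--Lebesgue
  lemma applied to \<open>g x = f x / sin (\<pi> x)\<close>, which is continuous on \<open>[0, 1/2]\<close> for differentiable \<open>f\<close>
  with \<open>f 0 = 0\<close>, turns the integral of \<open>f x csc (\<pi> x)\<close> into twice the sum over \<open>k\<close> of the
  integrals of \<open>f x sin ((2k + 1) \<pi> x)\<close>. For \<open>f = E\<^sub>2\<^sub>j\<close> each of these is evaluated by integrating
  by parts twice: as \<open>E\<^sub>2\<^sub>j\<close> vanishes at \<open>0\<close> and its derivative at \<open>1/2\<close>, there are no boundary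
  terms, and the result is \<open>(-1)\<^sup>j (2j)! / \<omega>\<^bsup>2j+1\<^esup>\<close> with \<open>\<omega> = (2k + 1) \<pi>\<close>. The sum over
  \<open>k\<close> is then the odd part of the zeta series.
\<close>

section \<open>Euler polynomials: derivative, reflection and special values\<close>

lemma euler_poly_sum:
  "euler_poly n x = fact n * (\<Sum>i\<le>n. fps_nth (2 / (fps_exp 1 + 1)) i * (x ^ (n - i) / fact (n - i)))"
  by (simp add: euler_poly_def fps_mult_nth atLeast0AtMost)

lemma euler_poly_0: "euler_poly 0 x = 1"
  by (simp add: euler_poly_sum fps_divide_nth_0)

text \<open>The coefficients of \<open>2 / (fps_exp 1 + 1)\<close> do not depend on x, so only the
  factors x^k / k! are differentiated. The inner function \<open>g\<close> makes the rule usable for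
  automatic differentiation of compositions.\<close>

lemma DERIV_euler_poly [derivative_intros]:
  assumes "(g has_real_derivative g') (at x within A)"
  shows "((\<lambda>x. euler_poly (Suc n) (g x)) has_real_derivative
           (real (Suc n) * euler_poly n (g x) * g')) (at x within A)"
proof -
  define a where "a = fps_nth (2 / (fps_exp 1 + 1) :: real fps)"
  have deriv_term: "((\<lambda>y. a i * (y ^ (Suc n - i) / fact (Suc n - i))) has_real_derivative
                 a i * (y ^ (n - i) / fact (n - i))) (at y)" if "i \<le> n" for i y
  proof -
    have "((\<lambda>y. y ^ Suc k / fact (Suc k)) has_real_derivative y ^ k / fact k) (at y)" for k
      using DERIV_cdivide [OF DERIV_pow [of "Suc k" y], of "fact (Suc k)"]
      by (simp del: of_nat_Suc power_Suc)
    from DERIV_cmult [OF this, of "a i" "n - i"] show ?thesis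
      using that by (simp add: Suc_diff_le del: of_nat_Suc power_Suc fact_Suc)
  qed
  \<comment> \<open>The summand of index \<open>Suc n\<close> carries y^0, so it is split off as a
    constant with derivative 0.\<close>
  have "((\<lambda>y. fact (Suc n) * ((\<Sum>i\<le>n. a i * (y ^ (Suc n - i) / fact (Suc n - i))) + a (Suc n)))
           has_real_derivative
           fact (Suc n) * ((\<Sum>i\<le>n. a i * (y ^ (n - i) / fact (n - i))) + 0)) (at y)" for y
    by (intro DERIV_cmult DERIV_add DERIV_sum DERIV_const deriv_term) auto
  then have "(euler_poly (Suc n) has_real_derivative real (Suc n) * euler_poly n y) (at y)" for y
    by (simp add: euler_poly_sum [abs_def] a_def algebra_simps)
  from DERIV_chain2 [OF this assms] show ?thesis .
qed

lemma continuous_on_euler_poly [continuous_intros]: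
  assumes "continuous_on A g"
  shows "continuous_on A (\<lambda>x. euler_poly n (g x))"
  unfolding euler_poly_sum by (intro continuous_intros assms) auto

lemma fps_exp_plus_1_nonzero: "fps_exp c + 1 \<noteq> (0 :: real fps)"
proof
  assume "fps_exp c + 1 = (0 :: real fps)"
  then have "fps_nth (fps_exp c + 1) 0 = fps_nth (0 :: real fps) 0" by simp
  then show False by simp
qed

lemma euler_generating_denominator: "2 / (fps_exp 1 + 1) * (fps_exp 1 + 1) = (2 :: real fps)"
  by (simp add: fps_divide_unit mult.assoc inverse_mult_eq_1)

text \<open>With A(t) = 2 / (e^t + 1) one has A(-t) = A(t) e^t. Hence replacing t by -t turns A(t)
  e^(xt) into A(t) e^((1 - x)t), and coefficients can be compared.\<close>

lemma euler_poly_reflect: "euler_poly n (1 - x) = (-1) ^ n * euler_poly n x"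
proof -
  define A :: "real fps" where "A = 2 / (fps_exp 1 + 1)"
  define B :: "real fps" where "B = A oo (- fps_X)"
  have A: "A * (fps_exp 1 + 1) = 2"
    unfolding A_def by (rule euler_generating_denominator)
  have "B * (fps_exp (- 1) + 1) = (2 :: real fps) oo (- fps_X)"
    unfolding B_def A [symmetric]
    by (simp add: fps_compose_mult_distrib fps_compose_add_distrib)
  then have B: "B * (fps_exp (- 1) + 1) = 2"
    by simp
  have "fps_exp 1 * fps_exp (- 1) = (1 :: real fps)"
    by (simp flip: fps_exp_add_mult)
  \<comment> \<open>Since (e^(-t) + 1) e^t = e^t + 1, both \<open>B\<close> and A(t) e^t give 2 e^t
    when multiplied by the nonzero series e^t + 1, which is then cancelled.\<close>
  then have "B * (fps_exp 1 + 1) = B * (fps_exp (- 1) + 1) * fps_exp 1"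
    by (simp add: distrib_left distrib_right mult.assoc mult.commute [of "fps_exp (- 1)"])
  then have "B * (fps_exp 1 + 1) = A * fps_exp 1 * (fps_exp 1 + 1)"
    unfolding B A [symmetric] by (simp only: mult_ac)
  then have BA: "B = A * fps_exp 1"
    using fps_exp_plus_1_nonzero by simp
  have "A * fps_exp x oo (- fps_X) = A * fps_exp 1 * fps_exp (- x)"
    by (simp add: fps_compose_mult_distrib BA flip: B_def)
  also have "\<dots> = A * fps_exp (1 - x)"
    by (simp add: mult.assoc flip: fps_exp_add_mult)
  finally have "Abs_fps (\<lambda>n. (-1) ^ n * fps_nth (A * fps_exp x) n) = A * fps_exp (1 - x)"
    by (simp add: fps_compose_uminus')
  then have "fps_nth (A * fps_exp (1 - x)) n = (-1) ^ n * fps_nth (A * fps_exp x) n"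
    by (metis fps_nth_Abs_fps)
  then show ?thesis
    by (simp add: euler_poly_def flip: A_def)
qed

text \<open>The relation A(t) e^t + A(t) = 2 makes the values at 1 and 0 opposite for n > 0, while
  reflection makes them equal for even n.\<close>

lemma euler_poly_even_at_0:
  assumes "even n" "n > 0"
  shows "euler_poly n 0 = 0"
proof -
  define A :: "real fps" where "A = 2 / (fps_exp 1 + 1)"
  have "A * fps_exp 1 + A * fps_exp 0 = 2"
    using euler_generating_denominator by (simp add: A_def distrib_left)
  then have "fps_nth (A * fps_exp 1 + A * fps_exp 0) n = fps_nth 2 n"
    by simp
  then have "fps_nth (A * fps_exp 1) n + fps_nth (A * fps_exp 0) n = 0"
    using assms by (simp add: fps_numeral_nth)
  then have "euler_poly n 1 + euler_poly n 0 = 0"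
    by (simp add: euler_poly_def flip: A_def distrib_left)
  moreover have "euler_poly n 1 = euler_poly n 0"
    using euler_poly_reflect [of n 0] assms by simp
  ultimately show ?thesis by simp
qed

lemma euler_poly_odd_at_half:
  assumes "odd n"
  shows "euler_poly n (1/2) = 0"
  using euler_poly_reflect [of n "1/2"] assms by simp

section \<open>Integrals of Euler polynomials against sines\<close>

lemma cos_odd_half_pi: "cos (pi * real (2 * k + 1) / 2) = 0"
proof -
  have "pi * real (2 * k + 1) / 2 = real k * pi + pi / 2"
    by (simp add: field_simps)
  then show ?thesis
    by (simp only: cos_add cos_pi_half sin_npi)
qed

lemma euler_poly_sin_integral:
  assumes w: "w = pi * real (2 * k + 1)"
  shows "((\<lambda>x. euler_poly (2 * j) x * sin (w * x)) has_integral
            (-1) ^ j * fact (2 * j) / w ^ (2 * j + 1)) {0..1/2}"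
proof (induction j)
  case 0
  \<comment> \<open>Here the polynomial is the constant 1, and the boundary term at 0 supplies the
    value 1 / w.\<close>
  have w0: "w \<noteq> 0" using w by (simp del: of_nat_Suc)
  have "((\<lambda>x. sin (w * x)) has_integral (- cos (w * (1/2)) / w - - cos (w * 0) / w)) {0..1/2}"
    by (rule fundamental_theorem_of_calculus)
       (auto intro!: derivative_eq_intros simp: w0 simp flip: has_real_derivative_iff_has_vector_derivative)
  then show ?case
    using cos_odd_half_pi [of k] by (simp add: euler_poly_0 w)
next
  case (Suc j)
  let ?m = "2 * j"
  have w0: "w \<noteq> 0" using w by (simp del: of_nat_Suc)
  let ?c = "real (Suc (Suc ?m)) * real (Suc ?m)"
  \<comment> \<open>Two integrations by parts packed into one antiderivative: the cosine terms with
    \<open>euler_poly (Suc ?m)\<close> coming from the two summands cancel on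
    differentiation.\<close>
  let ?F = "\<lambda>x. - euler_poly (Suc (Suc ?m)) x * cos (w * x) / w
                 + real (Suc (Suc ?m)) * euler_poly (Suc ?m) x * sin (w * x) / w ^ 2"
  have "((\<lambda>x. euler_poly (Suc (Suc ?m)) x * sin (w * x)
             + ?c / w ^ 2 * (euler_poly ?m x * sin (w * x))) has_integral ?F (1/2) - ?F 0) {0..1/2}"
    by (rule fundamental_theorem_of_calculus)
       (auto intro!: derivative_eq_intros
             simp: w0 divide_simps power2_eq_square algebra_simps
             simp del: of_nat_Suc simp flip: has_real_derivative_iff_has_vector_derivative)
  moreover have "?F (1/2) - ?F 0 = 0"
    using cos_odd_half_pi [of k] euler_poly_even_at_0 [of "Suc (Suc ?m)"]
      euler_poly_odd_at_half [of "Suc ?m"] by (simp add: w)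
  ultimately have "((\<lambda>x. euler_poly (Suc (Suc ?m)) x * sin (w * x)
             + ?c / w ^ 2 * (euler_poly ?m x * sin (w * x))) has_integral 0) {0..1/2}"
    by metis
  from has_integral_diff [OF this has_integral_mult_right [OF Suc.IH, of "?c / w ^ 2"]]
  have "((\<lambda>x. euler_poly (Suc (Suc ?m)) x * sin (w * x)) has_integral
          - (?c / w ^ 2 * ((-1) ^ j * fact ?m / w ^ (?m + 1)))) {0..1/2}"
    by simp
  moreover have "- (?c / w ^ 2 * ((-1) ^ j * fact ?m / w ^ (?m + 1)))
      = (-1) ^ Suc j * fact (2 * Suc j) / w ^ (2 * Suc j + 1)"
    using w0 by (simp add: divide_simps power2_eq_square algebra_simps)
  ultimately show ?case by simp
qed

section \<open>The Riemann-Lebesgue lemma for continuous functions\<close>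

lemma Riemann_Lebesgue_cos:
  fixes g :: "real \<Rightarrow> real"
  assumes ab: "a \<le> b" and g: "continuous_on {a..b} g"
  shows "((\<lambda>w. integral {a..b} (\<lambda>x. g x * cos (w * x))) \<longlongrightarrow> 0) at_top"
proof (rule tendstoI)
  fix e :: real assume e: "e > 0"
  \<comment> \<open>Stone-Weierstrass gives a polynomial \<open>p\<close> within \<open>d\<close> of
    \<open>g\<close>. The summand 1 in the denominator covers a = b and ensures d (b - a) < e /
    2.\<close>
  define d where "d = e / (2 * (b - a + 1))"
  have d: "d > 0" using e ab by (simp add: d_def)
  obtain p where p: "real_polynomial_function p" "\<And>x. x \<in> {a..b} \<Longrightarrow> \<bar>g x - p x\<bar> < d"
    using Stone_Weierstrass_real_polynomial_function [OF _ g d] by auto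
  then obtain p' where p': "polynomial_function p'" "\<And>x. (p has_real_derivative p' x) (at x)"
    using has_vector_derivative_polynomial_function [of p]
    by (auto simp: real_polynomial_function_eq has_real_derivative_iff_has_vector_derivative)
  have cp: "continuous_on {a..b} p" and cp': "continuous_on {a..b} p'"
    using p p' continuous_on_polymonial_function by (auto simp: real_polynomial_function_eq)
  obtain M where M: "\<And>x. x \<in> {a..b} \<Longrightarrow> \<bar>p' x\<bar> \<le> M"
    using compact_imp_bounded [OF compact_continuous_image [OF cp' compact_Icc]]
    unfolding bounded_iff real_norm_def by (meson imageI)
  have M0: "M \<ge> 0" using M [of a] ab by auto
  \<comment> \<open>Integrating p x cos (w x) by parts leaves boundary terms and the integral of p'
    x sin (w x) / w; together they are at most K / w.\<close>
  define K where "K = \<bar>p b\<bar> + \<bar>p a\<bar> + M * (b - a)"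
  have K0: "K \<ge> 0" using M0 ab by (simp add: K_def)
  have bound: "\<bar>integral {a..b} (\<lambda>x. g x * cos (w * x))\<bar> \<le> d * (b - a) + K / w" if w: "w > 0" for w
  proof -
    have "((\<lambda>x. p' x * sin (w * x) / w + p x * cos (w * x)) has_integral
             p b * sin (w * b) / w - p a * sin (w * a) / w) {a..b}"
      by (rule fundamental_theorem_of_calculus [OF ab])
         (use w in \<open>auto intro!: derivative_eq_intros DERIV_subset [OF p'(2)]
            simp: field_simps simp flip: has_real_derivative_iff_has_vector_derivative\<close>)
    then have "integral {a..b} (\<lambda>x. p' x * sin (w * x) / w + p x * cos (w * x))
        = p b * sin (w * b) / w - p a * sin (w * a) / w"
      by (rule integral_unique)
    moreover have "integral {a..b} (\<lambda>x. p' x * sin (w * x) / w + p x * cos (w * x))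
        = integral {a..b} (\<lambda>x. p' x * sin (w * x) / w) + integral {a..b} (\<lambda>x. p x * cos (w * x))"
      by (intro integral_add integrable_continuous_real continuous_intros cp cp') (use w in auto)
    moreover have "\<bar>integral {a..b} (\<lambda>x. p' x * sin (w * x) / w)\<bar> \<le> M / w * (b - a)"
      unfolding real_norm_def [symmetric]
    proof (rule integral_bound [OF ab])
      show "continuous_on {a..b} (\<lambda>x. p' x * sin (w * x) / w)"
        by (intro continuous_intros cp') (use w in auto)
      fix x assume "x \<in> {a..b}"
      then have "\<bar>p' x\<bar> * \<bar>sin (w * x)\<bar> \<le> M * 1"
        by (intro mult_mono M) (auto simp: M0)
      then show "norm (p' x * sin (w * x) / w) \<le> M / w"
        using w by (simp add: abs_mult divide_right_mono)
    qed
    moreover have "\<bar>p c * sin (w * c) / w\<bar> \<le> \<bar>p c\<bar> / w" for c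
      using w by (simp add: abs_mult mult_left_le divide_right_mono)
    ultimately have 1: "\<bar>integral {a..b} (\<lambda>x. p x * cos (w * x))\<bar> \<le> \<bar>p b\<bar> / w + \<bar>p a\<bar> / w + M / w * (b - a)"
      by (smt (verit))
    have "integral {a..b} (\<lambda>x. (g x - p x) * cos (w * x) + p x * cos (w * x))
        = integral {a..b} (\<lambda>x. (g x - p x) * cos (w * x)) + integral {a..b} (\<lambda>x. p x * cos (w * x))"
      by (intro integral_add integrable_continuous_real continuous_intros cp g)
    then have 2: "integral {a..b} (\<lambda>x. g x * cos (w * x))
        = integral {a..b} (\<lambda>x. (g x - p x) * cos (w * x)) + integral {a..b} (\<lambda>x. p x * cos (w * x))"
      by (simp add: left_diff_distrib)
    have 3: "\<bar>integral {a..b} (\<lambda>x. (g x - p x) * cos (w * x))\<bar> \<le> d * (b - a)"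
      unfolding real_norm_def [symmetric]
    proof (rule integral_bound [OF ab])
      show "continuous_on {a..b} (\<lambda>x. (g x - p x) * cos (w * x))"
        by (intro continuous_intros cp g)
      fix x assume "x \<in> {a..b}"
      then have "\<bar>g x - p x\<bar> * \<bar>cos (w * x)\<bar> \<le> d * 1"
        using d less_imp_le [OF p(2)] by (intro mult_mono) simp_all
      then show "norm ((g x - p x) * cos (w * x)) \<le> d"
        by (simp add: abs_mult)
    qed
    have "K / w = \<bar>p b\<bar> / w + \<bar>p a\<bar> / w + M / w * (b - a)"
      by (simp add: K_def add_divide_distrib)
    then show ?thesis using 1 2 3 by linarith
  qed
  have small: "d * (b - a) < e / 2"
    using e ab by (simp add: d_def divide_simps algebra_simps)
  show "\<forall>\<^sub>F w in at_top. dist (integral {a..b} (\<lambda>x. g x * cos (w * x))) 0 < e"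
    using eventually_gt_at_top [of "2 * K / e"] eventually_gt_at_top [of 0]
  proof eventually_elim
    case (elim w)
    then have "K / w < e / 2" using e by (simp add: field_simps)
    then show ?case using bound [of w] small elim unfolding dist_real_def by linarith
  qed
qed

section \<open>The cosecant integral as a series of sine integrals\<close>

lemma sin_mult_sum_sin_odd:
  fixes y :: real
  shows "2 * sin y * (\<Sum>k<n. sin (real (2 * k + 1) * y)) = 1 - cos (2 * real n * y)"
proof (induction n)
  case (Suc n)
  \<comment> \<open>The product-to-sum formula makes the sum telescope.\<close>
  have "2 * sin y * sin (real (2 * n + 1) * y) = cos (2 * real n * y) - cos (2 * real (Suc n) * y)"
    using cos_diff [of "real (2 * n + 1) * y" y] cos_add [of "real (2 * n + 1) * y" y]
    by (simp add: algebra_simps)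
  with Suc show ?case by (simp add: distrib_left)
qed simp

text \<open>The function \<open>g\<close> is the continuous extension of f x csc (\<pi> x) to 0. The
  n-th partial sum differs from its integral by the integral of g x cos (2\<pi>nx), which tends to
  0.\<close>

lemma integral_csc_sums:
  fixes f g :: "real \<Rightarrow> real"
  assumes g: "continuous_on {0..1/2} g" and f: "\<And>x. x \<in> {0..1/2} \<Longrightarrow> f x = g x * sin (pi * x)"
  shows "(\<lambda>k. 2 * integral {0..1/2} (\<lambda>x. f x * sin (pi * real (2 * k + 1) * x)))
           sums integral {0..1/2} (\<lambda>x. f x * csc (pi * x))"
proof -
  have fc: "continuous_on {0..1/2} f"
    by (subst continuous_on_cong [OF refl f]) (auto intro!: continuous_intros g)
  have csc: "integral {0..1/2} (\<lambda>x. f x * csc (pi * x)) = integral {0..1/2} g"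
  \<comment> \<open>At 0 the cosecant is 1 / 0 = 0, so the two integrands may differ there; a single
    point is negligible.\<close>
  proof (rule integral_spike [of "{0}"])
    fix x :: real assume x: "x \<in> {0..1/2} - {0}"
    then have "sin (pi * x) > 0"
      by (intro sin_gt_zero) (auto simp: field_simps)
    then show "g x = f x * csc (pi * x)"
      using x f [of x] by (simp add: csc_def)
  qed auto
  have part: "(\<Sum>k<n. 2 * integral {0..1/2} (\<lambda>x. f x * sin (pi * real (2 * k + 1) * x)))
      = integral {0..1/2} g - integral {0..1/2} (\<lambda>x. g x * cos (2 * pi * real n * x))" for n
  proof -
    have "(\<Sum>k<n. 2 * integral {0..1/2} (\<lambda>x. f x * sin (pi * real (2 * k + 1) * x)))
        = (\<Sum>k<n. integral {0..1/2} (\<lambda>x. 2 * (f x * sin (pi * real (2 * k + 1) * x))))"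
      by simp
    also have "\<dots> = integral {0..1/2} (\<lambda>x. \<Sum>k<n. 2 * (f x * sin (pi * real (2 * k + 1) * x)))"
      by (intro integral_sum [symmetric] integrable_continuous_real continuous_intros fc) auto
    also have "\<dots> = integral {0..1/2} (\<lambda>x. g x - g x * cos (2 * pi * real n * x))"
    proof (rule integral_cong)
      fix x :: real assume x: "x \<in> {0..1/2}"
      have "(\<Sum>k<n. 2 * (f x * sin (pi * real (2 * k + 1) * x)))
          = g x * (2 * sin (pi * x) * (\<Sum>k<n. sin (real (2 * k + 1) * (pi * x))))"
        using f [OF x] by (simp add: sum_distrib_left mult_ac)
      then show "(\<Sum>k<n. 2 * (f x * sin (pi * real (2 * k + 1) * x)))
          = g x - g x * cos (2 * pi * real n * x)"
        unfolding sin_mult_sum_sin_odd by (simp add: algebra_simps)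
    qed
    also have "\<dots> = integral {0..1/2} g - integral {0..1/2} (\<lambda>x. g x * cos (2 * pi * real n * x))"
      by (intro integral_diff integrable_continuous_real continuous_intros g)
    finally show ?thesis .
  qed
  have "filterlim (\<lambda>n. 2 * pi * real n) at_top sequentially"
    by (intro filterlim_tendsto_pos_mult_at_top [OF tendsto_const _ filterlim_real_sequentially]) auto
  then have "(\<lambda>n. integral {0..1/2} (\<lambda>x. g x * cos (2 * pi * real n * x))) \<longlonglongrightarrow> 0"
    using filterlim_compose [OF Riemann_Lebesgue_cos [OF _ g]] by simp
  then have "(\<lambda>n. integral {0..1/2} g - integral {0..1/2} (\<lambda>x. g x * cos (2 * pi * real n * x)))
      \<longlonglongrightarrow> integral {0..1/2} g - 0"
    by (intro tendsto_intros)
  then show ?thesis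
    unfolding sums_def part csc by simp
qed

text \<open>The value D / \<pi> at 0 is the limit of the ratio of the difference quotients of f x
  and sin (\<pi> x), both of which vanish at 0.\<close>

lemma continuous_on_divide_sin:
  fixes f :: "real \<Rightarrow> real"
  assumes f0: "f 0 = 0" and f': "(f has_real_derivative D) (at 0)"
    and cont: "continuous_on UNIV f"
  shows "continuous_on {0..1/2} (\<lambda>x. if x = 0 then D / pi else f x / sin (pi * x))"
    (is "continuous_on _ ?g")
proof (rule continuous_at_imp_continuous_on, rule ballI)
  fix x :: real assume x: "x \<in> {0..1/2}"
  show "isCont ?g x"
  proof (cases "x = 0")
    case True
    have "((\<lambda>x. sin (pi * x)) has_real_derivative pi) (at 0)"
      by (auto intro!: derivative_eq_intros)
    then have "(\<lambda>y. (f y / y) / (sin (pi * y) / y)) \<midarrow>0\<rightarrow> D / pi"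
      using f' f0 by (intro tendsto_divide) (auto simp: has_field_derivative_iff)
    moreover have "\<forall>\<^sub>F y in at 0. (f y / y) / (sin (pi * y) / y) = ?g y"
      by (auto simp: eventually_at intro!: exI [of _ 1])
    ultimately have "?g \<midarrow>0\<rightarrow> D / pi"
      by (rule Lim_transform_eventually)
    then show ?thesis using True by (simp add: isCont_def)
  next
    case False
    then have "sin (pi * x) > 0"
      using x by (intro sin_gt_zero) (auto simp: field_simps)
    moreover have "isCont f x"
      using cont by (simp add: continuous_on_eq_continuous_at)
    ultimately have "isCont (\<lambda>x. f x / sin (pi * x)) x"
      by (intro continuous_intros) auto
    moreover have "\<forall>\<^sub>F y in nhds x. ?g y = f y / sin (pi * y)"
      using t1_space_nhds [OF False] by eventually_elim simp
    ultimately show ?thesis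
      by (rule iffD2 [OF isCont_cong, rotated])
  qed
qed

section \<open>The odd part of the zeta series\<close>

lemma sums_odd_inverse_powers:
  fixes z :: real
  assumes "(\<lambda>n. 1 / real (Suc n) ^ s) sums z"
  shows "(\<lambda>k. 1 / real (2 * k + 1) ^ s) sums ((1 - 1 / 2 ^ s) * z)"
proof -
  let ?a = "\<lambda>n. 1 / real (Suc n) ^ s"
  \<comment> \<open>Consecutive terms are paired: each pair is an odd term plus 1 / 2^s times the
    n-th term of the full series, whose sum is then subtracted.\<close>
  have "(\<lambda>n. sum ?a {n * 2..<n * 2 + 2}) sums z"
    using sums_group [OF assms(1), of 2] by simp
  moreover have "sum ?a {n * 2..<n * 2 + 2} = 1 / real (2 * n + 1) ^ s + 1 / 2 ^ s * ?a n" for n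
  proof -
    have "{n * 2..<n * 2 + 2} = {2 * n, 2 * n + 1}" by auto
    moreover have "real (2 * n + 2) ^ s = 2 ^ s * real (Suc n) ^ s"
      by (simp add: algebra_simps flip: power_mult_distrib)
    ultimately show ?thesis by (simp add: add.commute)
  qed
  ultimately have "(\<lambda>n. 1 / real (2 * n + 1) ^ s + 1 / 2 ^ s * ?a n) sums z"
    by simp
  from sums_diff [OF this sums_mult [OF assms(1), of "1 / 2 ^ s"]]
  show ?thesis by (simp add: left_diff_distrib)
qed

lemma summable_inverse_Suc_power:
  assumes "n \<ge> 2"
  shows "summable (\<lambda>k. 1 / real (Suc k) ^ n)"
  using inverse_power_summable [OF assms, where ?'a = real]
    summable_Suc_iff [of "\<lambda>k. inverse (real k ^ n)"]
  by (simp add: inverse_eq_divide)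

lemma zeta_of_nat:
  assumes "n \<ge> 2"
  shows "zeta (of_nat n) = complex_of_real (\<Sum>k. 1 / real (Suc k) ^ n)"
proof -
  have "zeta (of_nat n) = (\<Sum>k. complex_of_real (1 / real (Suc k) ^ n))"
    using assms by (simp add: zeta_def powr_nat' del: of_nat_Suc)
  then show ?thesis
    using suminf_of_real [OF summable_inverse_Suc_power [OF assms], where ?'a = complex] by simp
qed

section \<open>Evaluation at odd integers\<close>

theorem corollary4p2:
  fixes j :: nat
  assumes "j \<ge> 1"
  shows "zeta (of_nat (2 * j + 1)) =
    complex_of_real
      ((-1) ^ j * (2 ^ (2 * j) * pi ^ (2 * j + 1)) / (fact (2 * j) * (2 ^ (2 * j + 1) - 1)) *
       integral {0..1/2} (\<lambda>x. euler_poly (2 * j) x * csc (pi * x)))"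
proof -
  define s where "s = 2 * j + 1"
  define z where "z = (\<Sum>k. 1 / real (Suc k) ^ s)"
  define I where "I = integral {0..1/2} (\<lambda>x. euler_poly (2 * j) x * csc (pi * x))"
  \<comment> \<open>Twice the sine integral for \<omega> = (2k + 1) \<pi> is \<open>C\<close> times
    1 / (2k + 1)^s.\<close>
  define C where "C = 2 * (-1) ^ j * fact (2 * j) / pi ^ s"
  let ?f = "euler_poly (2 * j)"
  \<comment> \<open>The derivative rule applies to indices of the form \<open>Suc m\<close>; j \<ge>
    1 makes 2j such an index.\<close>
  obtain m where m: "2 * j = Suc m"
    using assms by (cases "2 * j") auto
  have f0: "?f 0 = 0"
    using assms by (intro euler_poly_even_at_0) auto
  have f': "(?f has_real_derivative real (Suc m) * euler_poly m 0) (at 0)"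
    unfolding m by (auto intro!: derivative_eq_intros)
  let ?g = "\<lambda>x. if x = 0 then real (Suc m) * euler_poly m 0 / pi else ?f x / sin (pi * x)"
  have g: "continuous_on {0..1/2} ?g"
    by (intro continuous_on_divide_sin f0 f' continuous_intros)
  have fg: "?f x = ?g x * sin (pi * x)" if "x \<in> {0..1/2}" for x
  proof (cases "x = 0")
    case False
    with that have "sin (pi * x) > 0"
      by (intro sin_gt_zero) (auto simp: field_simps)
    with False show ?thesis by simp
  qed (simp add: f0)
  have "2 * integral {0..1/2} (\<lambda>x. ?f x * sin (pi * real (2 * k + 1) * x))
      = C * (1 / real (2 * k + 1) ^ s)" for k
    using integral_unique [OF euler_poly_sin_integral [OF refl, of j k]]
    by (simp add: C_def s_def power_mult_distrib del: power_Suc of_nat_add of_nat_mult)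
  then have "(\<lambda>k. C * (1 / real (2 * k + 1) ^ s)) sums I"
    using integral_csc_sums [OF g fg] by (simp only: I_def)
  moreover have "(\<lambda>k. 1 / real (Suc k) ^ s) sums z"
    unfolding z_def using assms by (intro summable_sums summable_inverse_Suc_power) (simp add: s_def)
  then have "(\<lambda>k. C * (1 / real (2 * k + 1) ^ s)) sums (C * ((1 - 1 / 2 ^ s) * z))"
    by (intro sums_mult sums_odd_inverse_powers)
  ultimately have I: "I = C * ((1 - 1 / 2 ^ s) * z)"
    by (rule sums_unique2)
  \<comment> \<open>To solve for \<open>z\<close>, the factor 2^s - 1 must be nonzero and (-1)^j
    must be its own inverse.\<close>
  have "(2::real) ^ s > 1"
    by (rule one_less_power) (simp_all add: s_def)
  moreover have "((-1) ^ j :: real) * (-1) ^ j = 1"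
    by (simp flip: power_mult_distrib)
  ultimately have "z = (-1) ^ j * (2 ^ (2 * j) * pi ^ s) / (fact (2 * j) * (2 ^ s - 1)) * I"
    unfolding I C_def by (simp add: s_def field_simps)
  moreover have "zeta (of_nat s) = complex_of_real z"
    unfolding z_def using assms by (intro zeta_of_nat) (simp add: s_def)
  ultimately show ?thesis
    by (simp only: s_def I_def)
qed

end
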